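(* Let $a>0$ and let $\phi(z)=cz+d$ where $c\in\mathbb{R}$ with $0<|c|\leq 1$ and $d\in\mathbb{C}$. Then the spectral radius $r(C_\phi)$ of the composition operator $C_\phi f=f\circ\phi$ on $B^2_a$ is: (1) $r(C_\phi)=e^{|\mathrm{Im}(d)|a}$, when $c=1$; (2) $r(C_\phi)=1/\sqrt{|c|}$, when $c\neq 1$.
   Context: For $a>0$, the Paley-Wiener space $B^2_a$ is the Hilbert space of all entire functions of exponential type less than or equal to $a$ whose restriction to $\mathbb{R}$ belongs to $L^2(\mathbb{R})$, with inner product $\langle f,g\rangle=\int_{-\infty}^{\infty}f(t)\overline{g(t)}\,dt$ and norm $\|\cdot\|_a$. For symbols $\phi(z)=cz+d$ ($z\in\mathbb{C}$) with $c\in\mathbb{R}$, $0<|c|\leq1$, $d\in\mathbb{C}$, the operator $C_\phi$ is a bounded linear operator on $B^2_a$. The spectral radius of a bounded operator $T$ is $r(T)=\lim_{n\to\infty}\|T^n\|^{1/n}$. *)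

theory Defs
  imports "HOL-Complex_Analysis.Complex_Analysis"
begin

text \<open>Type at most \<open>a\<close> means growth bounded by \<open>exp ((a + \<epsilon>) |z|)\<close> for every \<open>\<epsilon> > 0\<close>,
  the endpoint \<open>\<epsilon> = 0\<close> not being required.\<close>

definition exp_type_le :: "real \<Rightarrow> (complex \<Rightarrow> complex) \<Rightarrow> bool" where
  "exp_type_le a f \<longleftrightarrow>
     (\<forall>\<epsilon>>0. \<exists>K. \<forall>z. cmod (f z) \<le> K * exp ((a + \<epsilon>) * cmod z))"

definition paley_wiener :: "real \<Rightarrow> (complex \<Rightarrow> complex) set" where
  "paley_wiener a =
     {f. f holomorphic_on UNIV \<and> exp_type_le a f \<and>
         integrable lborel (\<lambda>t. (cmod (f (complex_of_real t)))\<^sup>2)}"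

definition pw_inner :: "(complex \<Rightarrow> complex) \<Rightarrow> (complex \<Rightarrow> complex) \<Rightarrow> complex" where
  "pw_inner f g = (LINT t|lborel. f (complex_of_real t) * cnj (g (complex_of_real t)))"

definition pw_norm :: "(complex \<Rightarrow> complex) \<Rightarrow> real" where
  "pw_norm f = sqrt (Re (pw_inner f f))"

definition pw_bounded_operator ::
    "real \<Rightarrow> ((complex \<Rightarrow> complex) \<Rightarrow> (complex \<Rightarrow> complex)) \<Rightarrow> bool" where
  "pw_bounded_operator a T \<longleftrightarrow>
     (\<forall>f\<in>paley_wiener a. T f \<in> paley_wiener a) \<and>
     (\<forall>f\<in>paley_wiener a. \<forall>g\<in>paley_wiener a. T (\<lambda>z. f z + g z) = (\<lambda>z. T f z + T g z)) \<and>
     (\<forall>f\<in>paley_wiener a. \<forall>k. T (\<lambda>z. k * f z) = (\<lambda>z. k * T f z)) \<and>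
     (\<exists>K. \<forall>f\<in>paley_wiener a. pw_norm (T f) \<le> K * pw_norm f)"

text \<open>The supremum is over a set bounded above, hence meaningful, only for bounded \<open>T\<close>.\<close>

definition pw_opnorm ::
    "real \<Rightarrow> ((complex \<Rightarrow> complex) \<Rightarrow> (complex \<Rightarrow> complex)) \<Rightarrow> real" where
  "pw_opnorm a T = (SUP f\<in>{f \<in> paley_wiener a. pw_norm f \<le> 1}. pw_norm (T f))"

text \<open>A relation rather than a value \<open>lim \<dots>\<close>, so that stating it includes that \<open>T\<close> is a
  bounded operator (needed for \<open>pw_opnorm\<close> to be meaningful) and that the limit exists.\<close>

definition has_pw_spectral_radius ::
    "real \<Rightarrow> ((complex \<Rightarrow> complex) \<Rightarrow> (complex \<Rightarrow> complex)) \<Rightarrow> real \<Rightarrow> bool" where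
  "has_pw_spectral_radius a T r \<longleftrightarrow>
     pw_bounded_operator a T \<and> (\<lambda>n. root n (pw_opnorm a (T ^^ n))) \<longlonglongrightarrow> r"

definition composition_operator ::
    "(complex \<Rightarrow> complex) \<Rightarrow> (complex \<Rightarrow> complex) \<Rightarrow> (complex \<Rightarrow> complex)" where
  "composition_operator \<phi> f = f \<circ> \<phi>"

end

theory Submission
  imports Defs "HOL-Probability.Sinc_Integral" "HOL-Real_Asymp.Real_Asymp"
begin

text \<open>
  The iterates of \<open>C\<^sub>\<phi>\<close> are composition operators with symbols \<open>c ^ n z + d (1 + c + \<dots> + c ^ (n - 1))\<close>,
  and the operator norm of composition with \<open>c z + w\<close> is exactly \<open>exp (a \<bar>Im w\<bar>) / sqrt \<bar>c\<bar>\<close>. The upper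
  bound is the Plancherel--Polya inequality on horizontal lines, which is deduced from the
  Phragmen--Lindelof bound \<open>\<bar>G z\<bar> \<le> M exp (a \<bar>Im z\<bar>)\<close> for functions of type \<open>a\<close> bounded by \<open>M\<close> on the
  real line. The spectral radius is therefore \<open>exp (a \<bar>Im d\<bar> s) / sqrt \<bar>c\<bar>\<close>, where \<open>s\<close> is the limit of
  the averages of \<open>1, c, c\<^sup>2, \<dots>\<close>, namely \<open>1\<close> if \<open>c = 1\<close> and \<open>0\<close> otherwise.
\<close>

subsection \<open>Functions of exponential type bounded on the real line\<close>

lemma holomorphic_on_affine:
  assumes "f holomorphic_on UNIV" shows "(\<lambda>z. f (c * z + d)) holomorphic_on UNIV"
proof -
  have "(f \<circ> (\<lambda>z. c * z + d)) holomorphic_on UNIV"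
    by (intro holomorphic_on_compose holomorphic_intros holomorphic_on_subset[OF assms]) auto
  then show ?thesis by (simp add: o_def)
qed

lemma exp_type_le_affine:
  assumes ty: "exp_type_le a f" and a: "a \<ge> 0" and c: "cmod c \<le> 1"
  shows "exp_type_le a (\<lambda>z. f (c * z + d))"
  unfolding exp_type_le_def
proof (intro allI impI)
  fix \<epsilon> :: real assume \<epsilon>: "\<epsilon> > 0"
  then obtain K where K: "\<And>z. cmod (f z) \<le> K * exp ((a + \<epsilon>) * cmod z)"
    using ty unfolding exp_type_le_def by blast
  have K0: "K \<ge> 0" using order_trans[OF norm_ge_zero K[of 0]] by simp
  have "cmod (f (c * z + d)) \<le> K * exp ((a + \<epsilon>) * cmod d) * exp ((a + \<epsilon>) * cmod z)" for z
  proof -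
    have "cmod (c * z + d) \<le> cmod z + cmod d"
      using mult_right_mono[OF c, of "cmod z"] norm_triangle_ineq[of "c * z" d] by (simp add: norm_mult)
    then have "(a + \<epsilon>) * cmod (c * z + d) \<le> (a + \<epsilon>) * (cmod z + cmod d)"
      using a \<epsilon> by (intro mult_left_mono) auto
    then have "K * exp ((a + \<epsilon>) * cmod (c * z + d)) \<le> K * exp ((a + \<epsilon>) * (cmod z + cmod d))"
      using K0 by (intro mult_left_mono) auto
    also have "\<dots> = K * exp ((a + \<epsilon>) * cmod d) * exp ((a + \<epsilon>) * cmod z)"
      by (simp add: distrib_left exp_add)
    finally show ?thesis using K[of "c * z + d"] by linarith
  qed
  then show "\<exists>K. \<forall>z. cmod (f (c * z + d)) \<le> K * exp ((a + \<epsilon>) * cmod z)" by blast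
qed

text \<open>With \<open>s = csqrt (z + 1)\<close> and \<open>z\<close> in the sector \<open>\<bar>Im z\<bar> \<le> Re z\<close>, the power \<open>s ^ 3\<close> has order
  \<open>3/2 > 1\<close> and real part comparable to its modulus, so \<open>exp (- \<delta> s ^ 3)\<close> beats every function of
  exponential type there.\<close>

lemma Re_cube_ge:
  fixes s :: complex
  assumes "Re s \<ge> 0" and "\<bar>Im (s\<^sup>2)\<bar> \<le> Re (s\<^sup>2)"
  shows "Re (s ^ 3) \<ge> Re s ^ 3 / 4" and "(cmod s)\<^sup>2 \<le> 5 / 4 * (Re s)\<^sup>2"
proof -
  define u v where "u = Re s" and "v = \<bar>Im s\<bar>"
  have uv: "u \<ge> 0" "v \<ge> 0" "v\<^sup>2 = (Im s)\<^sup>2"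
    using assms by (auto simp: u_def v_def)
  have "\<bar>Im (s\<^sup>2)\<bar> = 2 * u * v"
    using assms(1) by (simp add: power2_eq_square u_def v_def abs_mult flip: mult_2)
  moreover have "Re (s\<^sup>2) = u\<^sup>2 - v\<^sup>2"
    using uv by (simp add: power2_eq_square u_def)
  ultimately have le: "2 * u * v \<le> u\<^sup>2 - v\<^sup>2"
    using assms(2) by simp
  \<comment> \<open>In terms of arguments: \<open>s\<^sup>2\<close> lies within angle pi/4 of the
    positive axis, so \<open>s\<close> lies within pi/8, and tan(pi/8) = sqrt 2 - 1 < 1/2. The
    constants 1/4 and 5/4 below both come from \<open>v \<le> u / 2\<close>.\<close>
  have "2 * v \<le> u"
  proof (rule ccontr)
    assume *: "\<not> 2 * v \<le> u"
    then have "u * u \<le> u * (2 * v)" "v > 0" using uv by (auto intro!: mult_left_mono)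
    then have "v * v > 0" by simp
    then show False using le \<open>u * u \<le> u * (2 * v)\<close> by (simp add: power2_eq_square)
  qed
  then have "(2 * v)\<^sup>2 \<le> u\<^sup>2" using uv by (intro power_mono) auto
  then have v: "v\<^sup>2 \<le> u\<^sup>2 / 4" by (simp add: power_mult_distrib)
  have "Re (s ^ 3) = u ^ 3 - 3 * u * v\<^sup>2"
    using uv by (simp add: power2_eq_square power3_eq_cube u_def algebra_simps)
  also have "\<dots> \<ge> u ^ 3 - 3 * u * (u\<^sup>2 / 4)"
    using v uv by (intro diff_mono mult_left_mono) auto
  finally show "Re (s ^ 3) \<ge> Re s ^ 3 / 4"
    by (simp add: u_def power2_eq_square power3_eq_cube)
  show "(cmod s)\<^sup>2 \<le> 5 / 4 * (Re s)\<^sup>2"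
    using v uv by (simp add: cmod_power2 u_def)
qed

text \<open>A sector of opening pi/2 tolerates growth of any order below 2, in particular
  exponential type. The maximum principle is applied to
  \<open>h z * exp (- \<delta> * s z ^ 3)\<close> on the sector cut off at \<open>Re z = R\<close>:
  on the two rays the factor has modulus at most 1, on the vertical edge it beats \<open>h\<close>.
  Then \<delta> tends to 0.\<close>

lemma phragmen_lindelof_sector:
  assumes hol: "h holomorphic_on UNIV"
    and bd: "\<And>w. Re w \<ge> 0 \<Longrightarrow> \<bar>Im w\<bar> = Re w \<Longrightarrow> cmod (h w) \<le> M"
    and gr: "\<And>w. cmod (h w) \<le> K * exp (B * cmod w)"
    and pos: "M > 0" "K > 0" "B > 0"
    and w: "\<bar>Im w\<bar> \<le> Re w"
  shows "cmod (h w) \<le> M"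
proof -
  define s where "s = (\<lambda>z. csqrt (z + 1))"
  have s_props: "Re (s z ^ 3) \<ge> Re (s z) ^ 3 / 4" "cmod z \<le> 5 / 4 * (Re (s z))\<^sup>2" "Re (s z) \<ge> 0"
    if "\<bar>Im z\<bar> \<le> Re z" for z
  proof -
    have s0: "Re (s z) \<ge> 0" unfolding s_def using csqrt_principal[of "z + 1"] by auto
    have s2: "(s z)\<^sup>2 = z + 1" by (simp add: s_def)
    have c: "\<bar>Im ((s z)\<^sup>2)\<bar> \<le> Re ((s z)\<^sup>2)" using that by (simp add: s2)
    show "Re (s z ^ 3) \<ge> Re (s z) ^ 3 / 4" by (rule Re_cube_ge(1)[OF s0 c])
    have "(cmod z)\<^sup>2 \<le> (cmod (z + 1))\<^sup>2"
      unfolding cmod_power2 using that by (simp add: power2_sum)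
    then have "cmod z \<le> cmod (z + 1)" by (rule power2_le_imp_le) simp
    also have "\<dots> = (cmod (s z))\<^sup>2" by (metis s2 norm_power)
    also have "\<dots> \<le> 5 / 4 * (Re (s z))\<^sup>2" by (rule Re_cube_ge(2)[OF s0 c])
    finally show "cmod z \<le> 5 / 4 * (Re (s z))\<^sup>2" .
    show "Re (s z) \<ge> 0" by (rule s0)
  qed
  have main: "cmod (h w) * exp (- \<delta> * Re (s w ^ 3)) \<le> M" if \<delta>: "\<delta> > 0" for \<delta>
  proof -
    define F where "F = (\<lambda>z. h z * exp (- of_real \<delta> * s z ^ 3))"
    have Fnorm: "cmod (F z) = cmod (h z) * exp (- \<delta> * Re (s z ^ 3))" for z
      by (simp add: F_def norm_mult)
    \<comment> \<open>With \<open>u = Re (s z)\<close>, the growth of \<open>h\<close> is at most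
      quadratic in \<open>u\<close> inside the exponential, while the damping is cubic.\<close>
    have "((\<lambda>u. K * exp (B * (5 / 4 * u\<^sup>2) - \<delta> * (u ^ 3 / 4))) \<longlongrightarrow> 0) at_top"
      using pos \<delta> by real_asymp
    then have "eventually (\<lambda>u. K * exp (B * (5 / 4 * u\<^sup>2) - \<delta> * (u ^ 3 / 4)) < M) at_top"
      using pos by (auto dest: order_tendstoD)
    then obtain U where U: "\<And>u. u \<ge> U \<Longrightarrow> K * exp (B * (5 / 4 * u\<^sup>2) - \<delta> * (u ^ 3 / 4)) < M"
      by (auto simp: eventually_at_top_linorder)
    \<comment> \<open>The first entry puts \<open>w\<close> into the truncated sector; the second
      forces \<open>Re (s z) \<ge> U\<close> on the edge \<open>Re z = R\<close>, since
      \<open>cmod z\<close> is at most \<open>5 / 4 * (Re (s z))\<^sup>2\<close>.\<close>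
    define R where "R = max (cmod w) (5 / 4 * U\<^sup>2)"
    define S where "S = {z. \<bar>Im z\<bar> \<le> Re z \<and> Re z \<le> R}"
    have "closed S" unfolding S_def
      by (intro closed_Collect_conj closed_Collect_le continuous_intros)
    have S0: "S \<subseteq> {z. Re z > -1}" by (auto simp: S_def)
    \<comment> \<open>The shift by 1 inside \<open>csqrt\<close> keeps the vertex 0 of the sector
      away from the branch point, so \<open>F\<close> is holomorphic on a neighbourhood of the
      closed sector.\<close>
    have holF: "F holomorphic_on {z. Re z > -1}"
    proof -
      have "z + 1 \<notin> \<real>\<^sub>\<le>\<^sub>0" if "Re z > -1" for z
        using that by (auto simp: complex_nonpos_Reals_iff)
      then show ?thesis unfolding F_def s_def
        by (intro holomorphic_intros holomorphic_on_subset[OF hol]) auto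
    qed
    have "open {z. \<bar>Im z\<bar> < Re z \<and> Re z < R}"
      by (intro open_Collect_conj open_Collect_less continuous_intros)
    then have int: "{z. \<bar>Im z\<bar> < Re z \<and> Re z < R} \<subseteq> interior S"
      by (intro interior_maximal) (auto simp: S_def)
    have "cmod (F w) \<le> M"
    proof (rule maximum_modulus_frontier[of F S])
      show "F holomorphic_on interior S"
        using holF holomorphic_on_subset interior_subset S0 by (meson subset_trans)
      show "continuous_on (closure S) F"
        using holF \<open>closed S\<close> S0 by (metis closure_closed holomorphic_on_imp_continuous_on holomorphic_on_subset)
      have "cmod z \<le> 2 * R" if "z \<in> S" for z
        using that cmod_le[of z] by (auto simp: S_def)
      then show "bounded S" by (auto simp: bounded_iff)
      show "w \<in> S" using w complex_Re_le_cmod[of w] by (auto simp: S_def R_def)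
      fix z assume "z \<in> frontier S"
      then have zS: "z \<in> S" and nint: "z \<notin> {z. \<bar>Im z\<bar> < Re z \<and> Re z < R}"
        using int \<open>closed S\<close> by (auto simp: frontier_def closure_closed)
      have z: "\<bar>Im z\<bar> \<le> Re z" using zS by (simp add: S_def)
      note sp = s_props[OF z]
      show "cmod (F z) \<le> M"
      proof (cases "\<bar>Im z\<bar> = Re z")
        case True
        then have "cmod (h z) \<le> M" using bd z by force
        moreover have "exp (- \<delta> * Re (s z ^ 3)) \<le> 1"
        proof -
          have "0 \<le> Re (s z) ^ 3 / 4" using sp(3) by simp
          then have "0 \<le> Re (s z ^ 3)" using sp(1) by linarith
          then show ?thesis using \<delta> by simp
        qed
        ultimately show ?thesis
          unfolding Fnorm using mult_mono[of "cmod (h z)" M "exp (- \<delta> * Re (s z ^ 3))" 1] pos by simp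
      next
        case False
        then have "Re z = R" using z nint zS by (auto simp: S_def)
        then have "5 / 4 * U\<^sup>2 \<le> cmod z" using complex_Re_le_cmod[of z] by (simp add: R_def)
        then have "U\<^sup>2 \<le> (Re (s z))\<^sup>2" using sp(2) by linarith
        then have U': "U \<le> Re (s z)" using sp(3) power2_le_imp_le by blast
        have "cmod (F z) \<le> (K * exp (B * cmod z)) * exp (- \<delta> * Re (s z ^ 3))"
          unfolding Fnorm using gr by (intro mult_right_mono) auto
        also have "\<dots> = K * exp (B * cmod z - \<delta> * Re (s z ^ 3))"
          by (simp add: exp_diff exp_minus field_simps)
        also have "\<dots> \<le> K * exp (B * (5 / 4 * (Re (s z))\<^sup>2) - \<delta> * (Re (s z) ^ 3 / 4))"
          using sp pos \<delta> by (intro mult_left_mono exp_mono diff_mono) auto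
        also have "\<dots> \<le> M" using U[OF U'] by simp
        finally show ?thesis .
      qed
    qed
    then show ?thesis by (simp add: Fnorm)
  qed
  have "((\<lambda>\<delta>. cmod (h w) * exp (- \<delta> * Re (s w ^ 3))) \<longlongrightarrow> cmod (h w) * exp (- 0 * Re (s w ^ 3))) (at_right 0)"
    by (intro tendsto_intros)
  moreover have "eventually (\<lambda>\<delta>. cmod (h w) * exp (- \<delta> * Re (s w ^ 3)) \<le> M) (at_right 0)"
    using main by (auto simp: eventually_at_right_field intro!: exI[of _ 1])
  ultimately show ?thesis
    using tendsto_upperbound[of "\<lambda>\<delta>. cmod (h w) * exp (- \<delta> * Re (s w ^ 3))"
      "cmod (h w) * exp (- 0 * Re (s w ^ 3))" "at_right 0" M] by simp
qed

text \<open>The positive imaginary axis cuts the half-plane into two quadrants, each of opening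
  pi/2. Multiplication by \<open>1 + \<i>\<close> or \<open>\<i> - 1\<close> carries the sector
  about the positive real axis onto one of them, and its edges onto the half-axes where
  \<open>H\<close> is bounded. The modulus sqrt 2 of these factors is absorbed by doubling
  \<open>B\<close>.\<close>

lemma phragmen_lindelof_half_plane:
  assumes hol: "H holomorphic_on UNIV"
    and gr: "\<And>z. cmod (H z) \<le> K * exp (B * cmod z)"
    and re: "\<And>x. cmod (H (of_real x)) \<le> M"
    and im: "\<And>y. y \<ge> 0 \<Longrightarrow> cmod (H (\<i> * of_real y)) \<le> M"
    and pos: "M > 0" "K > 0" "B > 0"
    and z: "Im z \<ge> 0"
  shows "cmod (H z) \<le> M"
proof -
  have gr': "cmod (H (\<omega> * w)) \<le> K * exp ((B * 2) * cmod w)" if "cmod \<omega> \<le> 2" for \<omega> w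
  proof -
    have "B * cmod (\<omega> * w) \<le> (B * 2) * cmod w"
      using mult_right_mono[OF that, of "cmod w"] pos by (simp add: norm_mult)
    then show ?thesis using gr[of "\<omega> * w"] pos
      by (meson exp_mono mult_left_mono order_trans less_imp_le)
  qed
  have hol': "(\<lambda>w. H (\<omega> * w)) holomorphic_on UNIV" for \<omega>
    using holomorphic_on_affine[OF hol, of \<omega> 0] by simp
  show ?thesis
  proof (cases "Re z \<ge> 0")
    case True
    define w where "w = Complex ((Re z + Im z) / 2) ((Im z - Re z) / 2)"
    have zw: "z = (1 + \<i>) * w" by (simp add: w_def complex_eq_iff field_simps)
    have "cmod (H ((1 + \<i>) * w)) \<le> M"
    proof (rule phragmen_lindelof_sector[where h = "\<lambda>w. H ((1 + \<i>) * w)" and B = "B * 2", OF hol' _ gr'])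
      fix w assume w: "Re w \<ge> 0" "\<bar>Im w\<bar> = Re w"
      consider "(1 + \<i>) * w = of_real (2 * Re w)" | "(1 + \<i>) * w = \<i> * of_real (2 * Re w)"
        using w by (cases "Im w \<ge> 0") (auto simp: complex_eq_iff)
      then show "cmod (H ((1 + \<i>) * w)) \<le> M"
      proof cases
        case 1
        show ?thesis unfolding 1 by (rule re)
      next
        case 2
        show ?thesis unfolding 2 by (rule im) (use w in simp)
      qed
    next
      show "\<bar>Im w\<bar> \<le> Re w" using True z by (simp add: w_def)
    qed (use pos norm_triangle_ineq[of 1 \<i>] in auto)
    then show ?thesis using zw by simp
  next
    case False
    define w where "w = Complex ((Im z - Re z) / 2) (- (Re z + Im z) / 2)"
    have zw: "z = (\<i> - 1) * w" by (simp add: w_def complex_eq_iff field_simps)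
    have "cmod (H ((\<i> - 1) * w)) \<le> M"
    proof (rule phragmen_lindelof_sector[where h = "\<lambda>w. H ((\<i> - 1) * w)" and B = "B * 2", OF hol' _ gr'])
      fix w assume w: "Re w \<ge> 0" "\<bar>Im w\<bar> = Re w"
      consider "(\<i> - 1) * w = of_real (- 2 * Re w)" | "(\<i> - 1) * w = \<i> * of_real (2 * Re w)"
        using w by (cases "Im w \<ge> 0") (auto simp: complex_eq_iff)
      then show "cmod (H ((\<i> - 1) * w)) \<le> M"
      proof cases
        case 1
        show ?thesis unfolding 1 by (rule re)
      next
        case 2
        show ?thesis unfolding 2 by (rule im) (use w in simp)
      qed
    next
      show "\<bar>Im w\<bar> \<le> Re w" using False z by (simp add: w_def)
    qed (use pos norm_triangle_ineq4[of \<i> 1] in auto)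
    then show ?thesis using zw by simp
  qed
qed

text \<open>The maximum principle is applied to \<open>H ^ n / (z + \<i>)\<close>, which vanishes at infinity; the spurious
  factor \<open>\<bar>z + \<i>\<bar>\<close> disappears on taking \<open>n\<close>-th roots.\<close>

lemma bounded_half_plane_le_boundary:
  assumes hol: "H holomorphic_on UNIV"
    and C: "\<And>z. Im z \<ge> 0 \<Longrightarrow> cmod (H z) \<le> C"
    and M: "\<And>x. cmod (H (of_real x)) \<le> M" "M > 0"
    and z: "Im z \<ge> 0"
  shows "cmod (H z) \<le> M"
proof -
  have main: "cmod (H z) ^ n \<le> M ^ n * cmod (z + \<i>)" for n
  proof -
    define F where "F = (\<lambda>w. H w ^ n / (w + \<i>))"
    \<comment> \<open>On the arc \<open>cmod w = R\<close> the denominator has modulus at least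
      \<open>R - 1\<close>, so this radius makes the crude bound \<open>C ^ n\<close> at most
      \<open>M ^ n * cmod (w + \<i>)\<close>. The other entry keeps \<open>z\<close> inside.\<close>
    define R where "R = max (cmod z) (C ^ n / M ^ n + 1)"
    define S where "S = {w. Im w \<ge> 0 \<and> cmod w \<le> R}"
    have C0: "C \<ge> 0" using C[of 0] norm_ge_zero[of "H 0"] by (simp del: norm_ge_zero)
    have R: "C ^ n \<le> M ^ n * (R - 1)" "R \<ge> 1"
    proof -
      have "C ^ n / M ^ n \<le> R - 1" by (auto simp: R_def)
      then show "C ^ n \<le> M ^ n * (R - 1)" using M(2) by (simp add: field_simps)
      have "0 \<le> C ^ n / M ^ n" using C0 M(2) by simp
      then show "R \<ge> 1" by (simp add: R_def le_max_iff_disj)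
    qed
    have nz: "w + \<i> \<noteq> 0" "cmod (w + \<i>) \<ge> 1" if "Im w \<ge> 0" for w
    proof -
      show "cmod (w + \<i>) \<ge> 1" using that abs_Im_le_cmod[of "w + \<i>"] by simp
      then show "w + \<i> \<noteq> 0" by auto
    qed
    have "closed S" unfolding S_def
      by (intro closed_Collect_conj closed_Collect_le continuous_intros)
    have holF: "F holomorphic_on {w. Im w \<ge> 0}"
      unfolding F_def using nz(1) by (intro holomorphic_intros holomorphic_on_subset[OF hol]) auto
    have S0: "S \<subseteq> {w. Im w \<ge> 0}" by (auto simp: S_def)
    have "open {w. 0 < Im w \<and> cmod w < R}"
      by (intro open_Collect_conj open_Collect_less continuous_intros)
    then have int: "{w. 0 < Im w \<and> cmod w < R} \<subseteq> interior S"
      by (intro interior_maximal) (auto simp: S_def)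
    have "cmod (F z) \<le> M ^ n"
    proof (rule maximum_modulus_frontier[of F S])
      show "F holomorphic_on interior S"
        using holF holomorphic_on_subset interior_subset S0 by (meson subset_trans)
      show "continuous_on (closure S) F"
        using holF \<open>closed S\<close> S0 by (metis closure_closed holomorphic_on_imp_continuous_on holomorphic_on_subset)
      show "bounded S" by (auto simp: bounded_iff S_def)
      show "z \<in> S" using z by (auto simp: S_def R_def)
      fix w assume "w \<in> frontier S"
      then have wS: "w \<in> S" and nint: "w \<notin> {w. 0 < Im w \<and> cmod w < R}"
        using int \<open>closed S\<close> by (auto simp: frontier_def closure_closed)
      have w: "Im w \<ge> 0" using wS by (simp add: S_def)
      have "cmod (H w) ^ n \<le> M ^ n * cmod (w + \<i>)"
      proof (cases "Im w = 0")
        case True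
        then have "w = of_real (Re w)" by (simp add: complex_eq_iff)
        then have "cmod (H w) ^ n \<le> M ^ n" using M(1)[of "Re w"] by (intro power_mono) auto
        also have "\<dots> \<le> M ^ n * cmod (w + \<i>)" using nz(2)[OF w] M(2) by simp
        finally show ?thesis .
      next
        case False
        then have "cmod w = R" using nint wS by (auto simp: S_def)
        then have "R - 1 \<le> cmod (w + \<i>)" using norm_diff_ineq[of w \<i>] by simp
        then have "M ^ n * (R - 1) \<le> M ^ n * cmod (w + \<i>)" using M(2) by (intro mult_left_mono) auto
        moreover have "cmod (H w) ^ n \<le> C ^ n" using C[OF w] by (intro power_mono) auto
        ultimately show ?thesis using R(1) by linarith
      qed
      then show "cmod (F w) \<le> M ^ n"
        using nz(2)[OF w] by (auto simp: F_def norm_divide norm_power divide_le_eq)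
    qed
    then show ?thesis
      using nz(2)[OF z] by (auto simp: F_def norm_divide norm_power divide_le_eq split: if_splits)
  qed
  show ?thesis
  proof (rule ccontr)
    assume "\<not> cmod (H z) \<le> M"
    then have "cmod (H z) / M > 1" using M(2) by simp
    then obtain n where "cmod (z + \<i>) < (cmod (H z) / M) ^ n" using real_arch_pow by blast
    then show False using main[of n] M(2) by (simp add: power_divide field_simps)
  qed
qed

text \<open>Multiplying \<open>G\<close> by \<open>exp (\<i> (a + \<epsilon>) z)\<close> leaves the
  modulus on the real line unchanged and cancels the growth on the positive imaginary axis, leaving
  the constant \<open>K\<close> there. Phragmen-Lindelof then bounds the product by
  \<open>max M K\<close> in the half-plane; once it is known to be bounded, the bound improves to
  \<open>M\<close>, which no longer depends on \<epsilon>, and \<epsilon> tends to 0.\<close>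

lemma exp_type_bound_upper:
  assumes hol: "G holomorphic_on UNIV" and ty: "exp_type_le a G"
    and M: "\<And>x. cmod (G (of_real x)) \<le> M" "M > 0"
    and a: "a > 0" and z: "Im z \<ge> 0"
  shows "cmod (G z) \<le> M * exp (a * Im z)"
proof -
  have main: "cmod (G z) \<le> M * exp ((a + \<epsilon>) * Im z)" if \<epsilon>: "\<epsilon> > 0" for \<epsilon>
  proof -
    obtain K0 where K0: "\<And>z. cmod (G z) \<le> K0 * exp ((a + \<epsilon>) * cmod z)"
      using ty \<epsilon> unfolding exp_type_le_def by blast
    define K where "K = max K0 1"
    have "K > 0" "K0 \<le> K" by (auto simp: K_def)
    then have K: "K > 0" "cmod (G z) \<le> K * exp ((a + \<epsilon>) * cmod z)" for z
      using order_trans[OF K0[of z] mult_right_mono[of K0 K "exp ((a + \<epsilon>) * cmod z)"]] by auto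
    define H where "H = (\<lambda>z. G z * exp (\<i> * of_real (a + \<epsilon>) * z))"
    have holH: "H holomorphic_on UNIV" unfolding H_def by (intro holomorphic_intros hol)
    have Hn: "cmod (H z) = cmod (G z) * exp (- ((a + \<epsilon>) * Im z))" for z
      by (simp add: H_def norm_mult)
    have C: "cmod (H z) \<le> max M K" if "Im z \<ge> 0" for z
    proof (rule phragmen_lindelof_half_plane[OF holH _ _ _ _ _ _ that, where B = "2 * (a + \<epsilon>)" and K = K])
      fix z
      have "- ((a + \<epsilon>) * Im z) \<le> (a + \<epsilon>) * cmod z"
        using mult_left_mono[of "- Im z" "cmod z" "a + \<epsilon>"] abs_Im_le_cmod[of z] a \<epsilon> by simp
      then have "cmod (H z) \<le> (K * exp ((a + \<epsilon>) * cmod z)) * exp ((a + \<epsilon>) * cmod z)"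
        unfolding Hn using K by (intro mult_mono) auto
      also have "\<dots> = K * exp (2 * (a + \<epsilon>) * cmod z)"
        by (simp flip: exp_add add: algebra_simps)
      finally show "cmod (H z) \<le> \<dots>" .
    next
      fix x show "cmod (H (of_real x)) \<le> max M K" using M(1)[of x] by (simp add: Hn)
    next
      fix y :: real assume "y \<ge> 0"
      then have "cmod (G (\<i> * of_real y)) \<le> K * exp ((a + \<epsilon>) * y)"
        using K(2)[of "\<i> * of_real y"] by (simp add: norm_mult)
      then have "cmod (H (\<i> * of_real y)) \<le> K * exp ((a + \<epsilon>) * y) * exp (- ((a + \<epsilon>) * y))"
        unfolding Hn by simp
      also have "\<dots> = K" by (simp only: mult.assoc flip: exp_add) simp
      finally show "cmod (H (\<i> * of_real y)) \<le> max M K" by simp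
    qed (use M K a \<epsilon> in auto)
    have "cmod (H z) \<le> M"
      using bounded_half_plane_le_boundary[OF holH C _ M(2) z] M(1) by (simp add: Hn)
    then have "cmod (G z) * exp (- ((a + \<epsilon>) * Im z)) * exp ((a + \<epsilon>) * Im z)
        \<le> M * exp ((a + \<epsilon>) * Im z)"
      unfolding Hn by (intro mult_right_mono) auto
    then show ?thesis by (simp only: mult.assoc flip: exp_add) simp
  qed
  have "((\<lambda>\<epsilon>. M * exp ((a + \<epsilon>) * Im z)) \<longlongrightarrow> M * exp ((a + 0) * Im z)) (at_right 0)"
    by (intro tendsto_intros)
  moreover have "eventually (\<lambda>\<epsilon>. cmod (G z) \<le> M * exp ((a + \<epsilon>) * Im z)) (at_right 0)"
    using main by (auto simp: eventually_at_right_field intro!: exI[of _ 1])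
  ultimately show ?thesis
    using tendsto_lowerbound[of "\<lambda>\<epsilon>. M * exp ((a + \<epsilon>) * Im z)" "M * exp ((a + 0) * Im z)" "at_right 0" "cmod (G z)"] by simp
qed

lemma exp_type_bound:
  assumes hol: "G holomorphic_on UNIV" and ty: "exp_type_le a G"
    and M: "\<And>x. cmod (G (of_real x)) \<le> M" "M > 0" and a: "a > 0"
  shows "cmod (G z) \<le> M * exp (a * \<bar>Im z\<bar>)"
proof (cases "Im z \<ge> 0")
  case True
  then show ?thesis using exp_type_bound_upper[OF assms True] by simp
next
  case False
  have "(\<lambda>z. G (- z)) holomorphic_on UNIV"
    using holomorphic_on_affine[OF hol, of "- 1" 0] by simp
  moreover have "exp_type_le a (\<lambda>z. G (- z))"
    using exp_type_le_affine[OF ty, of "- 1" 0] a by simp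
  moreover have "cmod (G (- of_real x)) \<le> M" for x using M(1)[of "- x"] by simp
  ultimately show ?thesis
    using exp_type_bound_upper[of "\<lambda>z. G (- z)" a M "- z"] M(2) a False by simp
qed

subsection \<open>The Plancherel--Polya inequality\<close>

lemma pw_norm_eq: "pw_norm f = sqrt (LINT t|lborel. (cmod (f (of_real t)))\<^sup>2)"
proof -
  have "pw_inner f f = (LINT t|lborel. complex_of_real ((cmod (f (of_real t)))\<^sup>2))"
    unfolding pw_inner_def by (simp add: complex_norm_square del: of_real_power)
  then show ?thesis by (simp add: pw_norm_def del: of_real_power)
qed

lemma pw_norm_power2: "(pw_norm f)\<^sup>2 = (LINT t|lborel. (cmod (f (of_real t)))\<^sup>2)"
  by (simp add: pw_norm_eq)

lemma pw_norm_nonneg: "pw_norm f \<ge> 0"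
  by (simp add: pw_norm_eq)

lemma integral_Icc_le_lborel:
  fixes h :: "real \<Rightarrow> real"
  assumes "continuous_on UNIV h" "\<And>t. h t \<ge> 0" "integrable lborel h"
  shows "integral {p..q} h \<le> (LINT t|lborel. h t)"
proof -
  have si: "set_integrable lborel {p..q} h"
    by (rule borel_integrable_atLeastAtMost') (rule continuous_on_subset[OF assms(1)], simp)
  have "integral {p..q} h = (LINT t:{p..q}|lborel. h t)"
    using set_borel_integral_eq_integral(2)[OF si] by simp
  also have "\<dots> \<le> (LINT t|lborel. h t)"
    using si assms unfolding set_lebesgue_integral_def set_integrable_def
    by (intro integral_mono) (auto simp: indicator_def)
  finally show ?thesis .
qed

text \<open>Monotone convergence along the exhaustion by \<open>[-n, n]\<close>. Integrability comes
  out as a conclusion, which is what makes a bound uniform in \<open>n\<close> sufficient for the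
  Plancherel-Polya inequality.\<close>

lemma lborel_integrable_if_integral_Icc_bounded:
  fixes h :: "real \<Rightarrow> real"
  assumes cont: "continuous_on UNIV h" and nn: "\<And>t. h t \<ge> 0"
    and bd: "\<And>n::nat. integral {- real n..real n} h \<le> C"
  shows "integrable lborel h" and "(LINT t|lborel. h t) \<le> C"
proof -
  define F where "F = (\<lambda>(n::nat) t. indicator {- real n..real n} t * h t)"
  have si: "set_integrable lborel {- real n..real n} h" for n
    by (rule borel_integrable_atLeastAtMost') (rule continuous_on_subset[OF cont], simp)
  have int: "integrable lborel (F n)" for n
    using si[of n] by (simp add: F_def set_integrable_def)
  have val: "integral\<^sup>L lborel (F n) = integral {- real n..real n} h" for n
    using set_borel_integral_eq_integral(2)[OF si[of n]]
    by (simp add: F_def set_lebesgue_integral_def)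
  have mono: "mono (\<lambda>n. F n t)" for t
    unfolding F_def mono_def by (auto simp: indicator_def nn)
  have lim: "(\<lambda>n. F n t) \<longlonglongrightarrow> h t" for t
  proof (rule tendsto_eventually)
    obtain N :: nat where "\<bar>t\<bar> \<le> N" using real_arch_simple by blast
    then have "F n t = h t" if "n \<ge> N" for n using that by (auto simp: F_def indicator_def)
    then show "\<forall>\<^sub>F n in sequentially. F n t = h t" unfolding eventually_sequentially by blast
  qed
  have "incseq (\<lambda>n. integral\<^sup>L lborel (F n))"
    using mono int by (auto simp: mono_def intro!: integral_mono)
  then obtain L where L: "(\<lambda>n. integral\<^sup>L lborel (F n)) \<longlonglongrightarrow> L"
    using incseq_convergent[of "\<lambda>n. integral\<^sup>L lborel (F n)" C] val bd by metis
  have meas: "h \<in> borel_measurable lborel"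
    using cont by (simp add: borel_measurable_continuous_onI)
  show "integrable lborel h"
    by (rule integrable_monotone_convergence[of lborel F h L]) (use int mono lim L meas in auto)
  have "(LINT t|lborel. h t) = L"
    by (rule integral_monotone_convergence[of lborel F h L]) (use int mono lim L meas in auto)
  moreover have "L \<le> C" using L val bd by (intro LIMSEQ_le_const2[OF L]) auto
  ultimately show "(LINT t|lborel. h t) \<le> C" by simp
qed

lemma continuous_on_cmod_power2:
  assumes "f holomorphic_on UNIV"
  shows "continuous_on UNIV (\<lambda>t::real. (cmod (f (z + of_real t)))\<^sup>2)"
  by (intro continuous_intros continuous_on_compose2[OF holomorphic_on_imp_continuous_on[OF assms]]) auto

text \<open>Testing \<open>f\<close> on the line \<open>Im z = y\<close> against itself: \<open>G z = \<integral> f (z + t) cnj (f (\<i> y + t)) dt\<close> over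
  \<open>[-n, n]\<close> is entire of type \<open>a\<close>, its value at \<open>\<i> y\<close> is the integral \<open>B\<close> to be bounded, and AM-GM
  with weight \<open>E = exp (a \<bar>y\<bar>)\<close> bounds \<open>G\<close> on the real line by \<open>(E A + B / E) / 2\<close>. The weight is
  chosen so that the resulting inequality \<open>B \<le> E (E A + B / E) / 2\<close> reads \<open>B \<le> E\<^sup>2 A\<close>.\<close>

lemma paley_wiener_integral_Icc_le:
  assumes f: "f \<in> paley_wiener a" and a: "a > 0"
  shows "integral {- real n..real n} (\<lambda>t. (cmod (f (\<i> * of_real y + of_real t)))\<^sup>2)
         \<le> exp (2 * a * \<bar>y\<bar>) * (pw_norm f)\<^sup>2"
proof -
  define g where "g = (\<lambda>t::real. f (\<i> * of_real y + of_real t))"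
  define E where "E = exp (a * \<bar>y\<bar>)"
  define A where "A = (pw_norm f)\<^sup>2"
  define B where "B = integral {- real n..real n} (\<lambda>t. (cmod (g t))\<^sup>2)"
  define M where "M = (E * A + B / E) / 2"
  define G where "G = (\<lambda>z. integral (cbox (- real n) (real n)) (\<lambda>t. f (z + of_real t) * cnj (g t)))"
  have hol: "f holomorphic_on UNIV" and ty: "exp_type_le a f"
    and int: "integrable lborel (\<lambda>t. (cmod (f (of_real t)))\<^sup>2)"
    using f by (auto simp: paley_wiener_def)
  have cf: "continuous_on UNIV f" by (rule holomorphic_on_imp_continuous_on[OF hol])
  have cfz: "continuous_on S (\<lambda>t::real. f (z + of_real t))" for z S
    by (rule continuous_on_compose2[OF cf]) (auto intro!: continuous_intros)
  have cg: "continuous_on S g" for S unfolding g_def by (rule cfz)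
  have E: "E > 0" by (simp add: E_def)
  have A0: "A \<ge> 0" by (simp add: A_def)
  have B0: "B \<ge> 0" unfolding B_def by (intro integral_nonneg integrable_continuous_interval continuous_intros cg) auto
  have igr: "(\<lambda>t. f (z + of_real t) * cnj (g t)) integrable_on {- real n..real n}" for z
    by (intro integrable_continuous_interval continuous_intros cfz cg)
  have holG: "G holomorphic_on UNIV"
    unfolding G_def
  proof (rule leibniz_rule_holomorphic[where fx = "\<lambda>z t. deriv f (z + of_real t) * cnj (g t)"])
    fix z :: complex and t :: real
    have "(f has_field_derivative deriv f (z + of_real t)) (at (z + of_real t))"
      using hol by (simp add: holomorphic_derivI)
    then have "((\<lambda>z. f (z + of_real t)) has_field_derivative deriv f (z + of_real t)) (at z)"
      by (simp add: DERIV_shift)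
    then show "((\<lambda>z. f (z + of_real t) * cnj (g t)) has_field_derivative
        deriv f (z + of_real t) * cnj (g t)) (at z within UNIV)"
      by (rule DERIV_cmult_right)
  next
    have "continuous_on UNIV (deriv f)"
      using hol by (intro holomorphic_on_imp_continuous_on holomorphic_deriv) auto
    then have "continuous_on S (\<lambda>p. deriv f (fst p + of_real (snd p)))" for S :: "(complex \<times> real) set"
      by (rule continuous_on_compose2) (auto intro!: continuous_intros)
    moreover have "continuous_on S (\<lambda>p. g (snd p))" for S :: "(complex \<times> real) set"
      by (rule continuous_on_compose2[OF cg[of UNIV]]) (auto intro!: continuous_intros)
    ultimately show "continuous_on (UNIV \<times> cbox (- real n) (real n))
        (\<lambda>(z, t). deriv f (z + of_real t) * cnj (g t))"
      unfolding case_prod_beta by (intro continuous_intros)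
  qed (use igr in auto)
  \<comment> \<open>The bounded window keeps the type at \<open>a\<close>: shifting by
    \<open>t\<close> costs at most the constant factor \<open>exp ((a + \<epsilon>) * n)\<close>.
    Its dependence on \<open>n\<close> is harmless, because the resulting bound for \<open>B\<close>
    involves only the type of \<open>G\<close> and its values on the real line.\<close>
  have tyG: "exp_type_le a G"
    unfolding exp_type_le_def
  proof (intro allI impI)
    fix \<epsilon> :: real assume \<epsilon>: "\<epsilon> > 0"
    then obtain K where K: "\<And>z. cmod (f z) \<le> K * exp ((a + \<epsilon>) * cmod z)"
      using ty unfolding exp_type_le_def by blast
    have K0: "K \<ge> 0" using order_trans[OF norm_ge_zero K[of 0]] by simp
    have "cmod (G z) \<le> (K * exp ((a + \<epsilon>) * real n) * integral {- real n..real n} (\<lambda>t. cmod (g t)))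
            * exp ((a + \<epsilon>) * cmod z)" for z
    proof -
      have "cmod (G z) \<le> integral {- real n..real n}
              (\<lambda>t. (K * exp ((a + \<epsilon>) * (cmod z + real n))) * cmod (g t))"
        unfolding G_def cbox_interval
      proof (rule integral_norm_bound_integral[OF igr])
        show "(\<lambda>t. (K * exp ((a + \<epsilon>) * (cmod z + real n))) * cmod (g t)) integrable_on {- real n..real n}"
          by (intro integrable_continuous_interval continuous_intros cg)
        fix t assume "t \<in> {- real n..real n}"
        then have "cmod (of_real t) \<le> real n" by auto
        then have "cmod (z + of_real t) \<le> cmod z + real n"
          using norm_triangle_ineq[of z "of_real t"] by linarith
        then have "(a + \<epsilon>) * cmod (z + of_real t) \<le> (a + \<epsilon>) * (cmod z + real n)"
          using a \<epsilon> by (intro mult_left_mono) auto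
        then have "K * exp ((a + \<epsilon>) * cmod (z + of_real t)) \<le> K * exp ((a + \<epsilon>) * (cmod z + real n))"
          using K0 by (intro mult_left_mono) auto
        with K[of "z + of_real t"] show "cmod (f (z + of_real t) * cnj (g t))
            \<le> (K * exp ((a + \<epsilon>) * (cmod z + real n))) * cmod (g t)"
          unfolding norm_mult complex_mod_cnj by (intro mult_right_mono) auto
      qed
      then show ?thesis by (simp add: distrib_left exp_add algebra_simps)
    qed
    then show "\<exists>K. \<forall>z. cmod (G z) \<le> K * exp ((a + \<epsilon>) * cmod z)" by blast
  qed
  have Gre: "cmod (G (of_real x)) \<le> M" for x
  proof -
    have i1: "(\<lambda>t. (cmod (f (of_real x + of_real t)))\<^sup>2) integrable_on {- real n..real n}"
      by (intro integrable_continuous_interval continuous_intros cfz)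
    have i2: "(\<lambda>t. (cmod (g t))\<^sup>2) integrable_on {- real n..real n}"
      by (intro integrable_continuous_interval continuous_intros cg)
    have "cmod (G (of_real x)) \<le> integral {- real n..real n}
        (\<lambda>t. E / 2 * (cmod (f (of_real x + of_real t)))\<^sup>2 + 1 / (2 * E) * (cmod (g t))\<^sup>2)"
      unfolding G_def cbox_interval
    proof (rule integral_norm_bound_integral[OF igr])
      fix t
      define p q where "p = cmod (f (of_real x + of_real t))" and "q = cmod (g t)"
      have "0 \<le> (E * p - q)\<^sup>2 / (2 * E)" using E by simp
      also have "\<dots> = E / 2 * p\<^sup>2 + 1 / (2 * E) * q\<^sup>2 - p * q"
        using E by (simp add: field_simps power2_eq_square)
      finally show "cmod (f (of_real x + of_real t) * cnj (g t))
          \<le> E / 2 * (cmod (f (of_real x + of_real t)))\<^sup>2 + 1 / (2 * E) * (cmod (g t))\<^sup>2"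
        by (simp add: norm_mult p_def q_def)
    qed (intro integrable_add integrable_on_mult_right i1 i2)
    also have "\<dots> = E / 2 * integral {- real n..real n} (\<lambda>t. (cmod (f (of_real x + of_real t)))\<^sup>2)
        + 1 / (2 * E) * B"
      unfolding B_def
      by (subst integral_add[OF integrable_on_mult_right[OF i1] integrable_on_mult_right[OF i2]])
        (simp only: integral_mult_right)
    also have "integral {- real n..real n} (\<lambda>t. (cmod (f (of_real x + of_real t)))\<^sup>2) \<le> A"
    proof -
      have "integral {- real n..real n} (\<lambda>t. (cmod (f (of_real x + of_real t)))\<^sup>2)
          \<le> (LINT t|lborel. (cmod (f (of_real x + of_real t)))\<^sup>2)"
        using lborel_integrable_real_affine[OF int, of 1 x]
        by (intro integral_Icc_le_lborel continuous_on_cmod_power2 hol) auto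
      also have "\<dots> = A"
        unfolding A_def pw_norm_power2
        using lborel_integral_real_affine[of 1 "\<lambda>t. (cmod (f (of_real t)))\<^sup>2" x] by simp
      finally show ?thesis .
    qed
    finally show ?thesis using E by (simp add: M_def field_simps)
  qed
  have "B \<le> E\<^sup>2 * A"
  \<comment> \<open>The bound \<open>exp_type_bound\<close> requires \<open>M > 0\<close>, which
    \<open>B > 0\<close> guarantees.\<close>
  proof (cases "B = 0")
    case True
    then show ?thesis using A0 by simp
  next
    case False
    have M: "M > 0" using False A0 B0 E unfolding M_def by (simp add: add_nonneg_pos)
    have "G (\<i> * of_real y) = integral {- real n..real n} (\<lambda>t. of_real ((cmod (g t))\<^sup>2))"
      unfolding G_def cbox_interval
      by (simp add: complex_norm_square g_def del: of_real_power)
    also have "\<dots> = of_real B"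
      unfolding B_def
      by (intro integral_unique has_integral_of_real integrable_integral integrable_continuous_interval
          continuous_intros cg)
    finally have "B = cmod (G (\<i> * of_real y))" using B0 by simp
    also have "\<dots> \<le> M * E"
      using exp_type_bound[OF holG tyG Gre M a, of "\<i> * of_real y"] by (simp add: E_def)
    also have "\<dots> = E\<^sup>2 * A / 2 + B / 2"
      using E by (simp add: M_def power2_eq_square field_simps)
    finally show ?thesis by simp
  qed
  moreover have "E\<^sup>2 = exp (2 * a * \<bar>y\<bar>)"
    by (simp add: E_def power2_eq_square flip: exp_add)
  ultimately show ?thesis by (simp add: B_def A_def g_def)
qed

theorem plancherel_polya:
  assumes f: "f \<in> paley_wiener a" and a: "a > 0"
  shows "integrable lborel (\<lambda>t. (cmod (f (\<i> * of_real y + of_real t)))\<^sup>2)"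
    and "(LINT t|lborel. (cmod (f (\<i> * of_real y + of_real t)))\<^sup>2)
           \<le> exp (2 * a * \<bar>y\<bar>) * (pw_norm f)\<^sup>2"
proof -
  have hol: "f holomorphic_on UNIV" using f by (simp add: paley_wiener_def)
  note * = lborel_integrable_if_integral_Icc_bounded[OF continuous_on_cmod_power2[OF hol] _
      paley_wiener_integral_Icc_le[OF f a]]
  show "integrable lborel (\<lambda>t. (cmod (f (\<i> * of_real y + of_real t)))\<^sup>2)" by (rule *) simp
  show "(LINT t|lborel. (cmod (f (\<i> * of_real y + of_real t)))\<^sup>2)
           \<le> exp (2 * a * \<bar>y\<bar>) * (pw_norm f)\<^sup>2" by (rule *) simp
qed

subsection \<open>Composition with affine maps\<close>

text \<open>Substitution \<open>t -> Re w + c t\<close> on the real line: the real part of the shift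
  disappears, and the norm depends only on the values of \<open>f\<close> on the line at height
  \<open>Im w\<close>.\<close>

lemma pw_norm_affine:
  assumes c: "c \<noteq> 0"
  shows "\<bar>c\<bar> * (pw_norm (\<lambda>z. f (of_real c * z + w)))\<^sup>2
         = (LINT t|lborel. (cmod (f (\<i> * of_real (Im w) + of_real t)))\<^sup>2)"
proof -
  have eq: "\<i> * of_real (Im w) + of_real (Re w + c * t) = of_real c * of_real t + w" for t
    by (simp add: complex_eq_iff)
  show ?thesis
    unfolding pw_norm_power2
    using lborel_integral_real_affine[OF c,
        of "\<lambda>t. (cmod (f (\<i> * of_real (Im w) + of_real t)))\<^sup>2" "Re w"]
    by (simp only: eq real_scaleR_def)
qed

lemma paley_wiener_affine:
  assumes f: "f \<in> paley_wiener a" and a: "a > 0" and c: "c \<noteq> 0" "\<bar>c\<bar> \<le> 1"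
  shows "(\<lambda>z. f (of_real c * z + w)) \<in> paley_wiener a"
proof -
  have eq: "\<i> * of_real (Im w) + of_real (Re w + c * t) = of_real c * of_real t + w" for t
    by (simp add: complex_eq_iff)
  have "integrable lborel (\<lambda>t. (cmod (f (of_real c * of_real t + w)))\<^sup>2)"
    using lborel_integrable_real_affine[OF plancherel_polya(1)[OF f a] c(1), of "Im w" "Re w"]
    by (simp only: eq)
  then show ?thesis
    using f a c exp_type_le_affine[of a f "of_real c" w] holomorphic_on_affine[of f "of_real c" w]
    by (auto simp: paley_wiener_def)
qed

lemma pw_norm_affine_le:
  assumes f: "f \<in> paley_wiener a" and a: "a > 0" and c: "c \<noteq> 0"
  shows "pw_norm (\<lambda>z. f (of_real c * z + w)) \<le> exp (a * \<bar>Im w\<bar>) / sqrt \<bar>c\<bar> * pw_norm f"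
proof (rule power2_le_imp_le)
  have "\<bar>c\<bar> * (pw_norm (\<lambda>z. f (of_real c * z + w)))\<^sup>2 \<le> exp (2 * a * \<bar>Im w\<bar>) * (pw_norm f)\<^sup>2"
    unfolding pw_norm_affine[OF c] by (rule plancherel_polya(2)[OF f a])
  moreover have "exp (2 * a * \<bar>Im w\<bar>) = (exp (a * \<bar>Im w\<bar>))\<^sup>2"
    by (simp add: power2_eq_square flip: exp_add)
  ultimately show "(pw_norm (\<lambda>z. f (of_real c * z + w)))\<^sup>2
      \<le> (exp (a * \<bar>Im w\<bar>) / sqrt \<bar>c\<bar> * pw_norm f)\<^sup>2"
    using c by (simp add: power_mult_distrib power_divide field_simps)
qed (simp add: pw_norm_nonneg)

text \<open>Vertical translation is invertible on the space, so the upper bound applied to the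
  translation back by \<open>- \<i> * Im w\<close> becomes a lower bound.\<close>

lemma pw_norm_affine_ge:
  assumes f: "f \<in> paley_wiener a" and a: "a > 0" and c: "c \<noteq> 0"
  shows "exp (- (a * \<bar>Im w\<bar>)) / sqrt \<bar>c\<bar> * pw_norm f \<le> pw_norm (\<lambda>z. f (of_real c * z + w))"
proof (rule power2_le_imp_le)
  define g where "g = (\<lambda>z. f (of_real 1 * z + \<i> * of_real (Im w)))"
  have g: "g \<in> paley_wiener a" unfolding g_def by (rule paley_wiener_affine[OF f a]) auto
  have "pw_norm f = pw_norm (\<lambda>z. g (of_real 1 * z + (- \<i> * of_real (Im w))))"
    by (simp add: g_def)
  also have "\<dots> \<le> exp (a * \<bar>Im w\<bar>) * pw_norm g"
    using pw_norm_affine_le[OF g a, of 1 "- \<i> * of_real (Im w)"] by simp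
  finally have "(pw_norm f)\<^sup>2 \<le> (exp (a * \<bar>Im w\<bar>) * pw_norm g)\<^sup>2"
    by (intro power_mono) (auto simp: pw_norm_nonneg)
  also have "\<dots> = (exp (a * \<bar>Im w\<bar>))\<^sup>2 * (\<bar>c\<bar> * (pw_norm (\<lambda>z. f (of_real c * z + w)))\<^sup>2)"
    unfolding pw_norm_affine[OF c] power_mult_distrib
    using pw_norm_affine[of 1 f "\<i> * of_real (Im w)"] by (simp add: g_def)
  finally show "(exp (- (a * \<bar>Im w\<bar>)) / sqrt \<bar>c\<bar> * pw_norm f)\<^sup>2
      \<le> (pw_norm (\<lambda>z. f (of_real c * z + w)))\<^sup>2"
    using c by (simp add: power_mult_distrib power_divide exp_minus field_simps)
qed (simp add: pw_norm_nonneg)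

section \<open>Test functions of small type and the exact operator norm\<close>

lemma pw_norm_cmult: "pw_norm (\<lambda>z. k * f z) = cmod k * pw_norm f"
  by (simp add: pw_norm_eq norm_mult power_mult_distrib real_sqrt_mult)

lemma pw_norm_cong: "(\<And>t. cmod (f (of_real t)) = cmod (g (of_real t))) \<Longrightarrow> pw_norm f = pw_norm g"
  by (simp add: pw_norm_eq)

text \<open>Modulation translates the spectrum by \<kappa>, so it can raise the type by at most
  \<open>\<bar>\<kappa>\<bar>\<close>, and it preserves moduli on the real line. The scalar
  \<open>k\<close> serves both to normalise test functions and, as \<open>k = 0\<close>, to produce
  the zero function.\<close>

lemma paley_wiener_mult_exp:
  assumes f: "f \<in> paley_wiener \<epsilon>" and \<kappa>: "\<epsilon> + \<bar>\<kappa>\<bar> \<le> a"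
  shows "(\<lambda>z. exp (\<i> * of_real \<kappa> * z) * (k * f z)) \<in> paley_wiener a"
proof -
  have hol: "f holomorphic_on UNIV" and ty: "exp_type_le \<epsilon> f"
    and int: "integrable lborel (\<lambda>t. (cmod (f (of_real t)))\<^sup>2)"
    using f by (auto simp: paley_wiener_def)
  have "exp_type_le a (\<lambda>z. exp (\<i> * of_real \<kappa> * z) * (k * f z))"
    unfolding exp_type_le_def
  proof (intro allI impI)
    fix \<eta> :: real assume "\<eta> > 0"
    then obtain K where K: "\<And>z. cmod (f z) \<le> K * exp ((\<epsilon> + \<eta>) * cmod z)"
      using ty unfolding exp_type_le_def by blast
    have K0: "K \<ge> 0" using order_trans[OF norm_ge_zero K[of 0]] by simp
    have "cmod (exp (\<i> * of_real \<kappa> * z) * (k * f z)) \<le> (cmod k * K) * exp ((a + \<eta>) * cmod z)" for z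
    proof -
      have "- (\<kappa> * Im z) \<le> \<bar>\<kappa>\<bar> * cmod z"
        using mult_mono[of "\<bar>\<kappa>\<bar>" "\<bar>\<kappa>\<bar>" "\<bar>Im z\<bar>" "cmod z"] abs_Im_le_cmod[of z]
        by (simp flip: abs_mult)
      then have "cmod (exp (\<i> * of_real \<kappa> * z)) \<le> exp (\<bar>\<kappa>\<bar> * cmod z)" by simp
      then have "cmod (exp (\<i> * of_real \<kappa> * z) * (k * f z))
          \<le> exp (\<bar>\<kappa>\<bar> * cmod z) * (cmod k * (K * exp ((\<epsilon> + \<eta>) * cmod z)))"
        unfolding norm_mult using K K0 by (intro mult_mono) auto
      also have "\<dots> = cmod k * K * exp ((\<epsilon> + \<bar>\<kappa>\<bar> + \<eta>) * cmod z)"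
        by (simp add: algebra_simps exp_add)
      also have "\<dots> \<le> cmod k * K * exp ((a + \<eta>) * cmod z)"
        using \<kappa> K0 by (intro mult_left_mono exp_mono mult_right_mono) auto
      finally show ?thesis .
    qed
    then show "\<exists>K. \<forall>z. cmod (exp (\<i> * of_real \<kappa> * z) * (k * f z)) \<le> K * exp ((a + \<eta>) * cmod z)"
      by blast
  qed
  moreover have "(\<lambda>z. exp (\<i> * of_real \<kappa> * z) * (k * f z)) holomorphic_on UNIV"
    by (intro holomorphic_intros hol)
  moreover have "integrable lborel (\<lambda>t. (cmod (exp (\<i> * of_real \<kappa> * of_real t) * (k * f (of_real t))))\<^sup>2)"
    using int by (simp add: norm_mult power_mult_distrib)
  ultimately show ?thesis by (simp add: paley_wiener_def)
qed

text \<open>The witness is \<open>sin (\<epsilon> z) / z\<close>, up to a constant the Fourier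
  transform of the indicator function of \<open>[-\<epsilon>, \<epsilon>]\<close>.\<close>

lemma paley_wiener_nontrivial:
  assumes e: "\<epsilon> > 0"
  obtains S where "S \<in> paley_wiener \<epsilon>" "pw_norm S > 0"
proof
  \<comment> \<open>The quotient is written as a difference quotient at 0, filled in there by the
    derivative, so that \<open>pole_lemma_open\<close> removes the singularity.\<close>
  define S where "S = (\<lambda>z::complex. if z = 0 then deriv (\<lambda>z. sin (of_real \<epsilon> * z)) 0
                        else (sin (of_real \<epsilon> * z) - sin (of_real \<epsilon> * 0)) / (z - 0))"
  have hol: "S holomorphic_on UNIV"
    unfolding S_def by (rule pole_lemma_open) (auto intro!: holomorphic_intros)
  have cont: "continuous_on X S" for X
    using holomorphic_on_imp_continuous_on[OF hol] continuous_on_subset by blast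
  have S: "S z = sin (of_real \<epsilon> * z) / z" if "z \<noteq> 0" for z
    using that by (simp add: S_def)
  have S0: "S 0 = of_real \<epsilon>"
    by (auto simp: S_def intro!: DERIV_imp_deriv derivative_eq_intros)
  \<comment> \<open>Near 0 division by \<open>z\<close> spoils the estimate of the sine, so
    compactness supplies the bound; \<open>K \<ge> 1\<close> lets the same constant serve outside
    the disc.\<close>
  have "compact (S ` cball 0 1)" by (intro compact_continuous_image cont) auto
  then obtain K where K: "\<And>z. cmod z \<le> 1 \<Longrightarrow> cmod (S z) \<le> K" "K \<ge> 1"
    by (auto dest!: compact_imp_bounded simp: bounded_pos_less)
       (metis (no_types) imageI mem_cball_0 less_imp_le max.cobounded1 max.cobounded2 order_trans)
  have ty: "exp_type_le \<epsilon> S"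
    unfolding exp_type_le_def
  proof (intro allI impI exI)
    fix \<eta> :: real and z assume \<eta>: "\<eta> > 0"
    have ex: "1 \<le> exp ((\<epsilon> + \<eta>) * cmod z)" using e \<eta> by simp
    show "cmod (S z) \<le> K * exp ((\<epsilon> + \<eta>) * cmod z)"
    proof (cases "cmod z \<le> 1")
      case True
      then show ?thesis using order_trans[OF K(1)[OF True], of "K * exp ((\<epsilon> + \<eta>) * cmod z)"] K(2) mult_left_mono[OF ex, of K] by simp
    next
      case False
      have "cmod (sin (of_real \<epsilon> * z)) \<le> exp (cmod (of_real \<epsilon> * z))"
        using cmod_sin_le_exp[of 1 "of_real \<epsilon> * z"] exp_mono[OF abs_Im_le_cmod[of "of_real \<epsilon> * z"]]
        unfolding scaleR_one by linarith
      also have "\<dots> \<le> exp ((\<epsilon> + \<eta>) * cmod z)"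
        using e \<eta> by (simp add: norm_mult mult_right_mono)
      finally have "cmod (sin (of_real \<epsilon> * z)) / cmod z \<le> exp ((\<epsilon> + \<eta>) * cmod z) / 1"
        using False by (intro frac_le) auto
      also have "\<dots> \<le> K * exp ((\<epsilon> + \<eta>) * cmod z)" using K(2) by simp
      finally show ?thesis using False by (subst S) (auto simp: norm_divide)
    qed
  qed
  have "integrable lborel (\<lambda>t. (cmod (S (of_real t)))\<^sup>2)"
  proof (rule Bochner_Integration.integrable_bound)
    \<comment> \<open>This majorant is at least \<open>K\<^sup>2\<close> for
      \<open>\<bar>t\<bar> \<le> 1\<close> and at least \<open>1 / t\<^sup>2\<close> beyond.\<close>
    show "integrable lborel (\<lambda>x::real. 2 * K\<^sup>2 * inverse (1 + x\<^sup>2))"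
      using integrable_inverse_1_plus_square by (simp add: set_integrable_def)
    show "(\<lambda>t. (cmod (S (of_real t)))\<^sup>2) \<in> borel_measurable lborel"
      using continuous_on_cmod_power2[OF hol, of 0] by (simp add: borel_measurable_continuous_onI)
    have "(cmod (S (of_real t)))\<^sup>2 \<le> 2 * K\<^sup>2 * inverse (1 + t\<^sup>2)" for t
    proof (cases "\<bar>t\<bar> \<le> 1")
      case True
      then have "(cmod (S (of_real t)))\<^sup>2 \<le> K\<^sup>2" using K by (intro power_mono) auto
      moreover have "1 \<le> 2 * inverse (1 + t\<^sup>2)"
        using True abs_square_le_1[of t] by (simp add: field_simps add_pos_nonneg)
      ultimately show ?thesis using mult_left_mono[of 1 "2 * inverse (1 + t\<^sup>2)" "K\<^sup>2"] by simp
    next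
      case False
      then have t: "t\<^sup>2 > 1" "t \<noteq> 0" using abs_square_le_1[of t] by auto
      have "(cmod (S (of_real t)))\<^sup>2 = (sin (\<epsilon> * t))\<^sup>2 / t\<^sup>2"
      proof -
        have "sin (of_real \<epsilon> * of_real t) = complex_of_real (sin (\<epsilon> * t))"
          by (metis of_real_mult sin_of_real)
        then show ?thesis using t by (simp add: S norm_divide power_divide)
      qed
      also have "\<dots> \<le> 1 / t\<^sup>2" by (intro divide_right_mono) (auto simp: abs_square_le_1)
      also have "\<dots> \<le> 2 * inverse (1 + t\<^sup>2)"
        using t by (simp add: field_simps)
      also have "\<dots> \<le> 2 * K\<^sup>2 * inverse (1 + t\<^sup>2)"
        using K(2) by (intro mult_right_mono) (auto simp: one_le_power)
      finally show ?thesis .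
    qed
    then show "AE t in lborel. norm ((cmod (S (of_real t)))\<^sup>2) \<le> norm (2 * K\<^sup>2 * inverse (1 + t\<^sup>2))"
      by (simp add: abs_mult)
  qed
  then show "S \<in> paley_wiener \<epsilon>" using hol ty by (simp add: paley_wiener_def)
  show "pw_norm S > 0"
  proof (rule ccontr)
    assume "\<not> pw_norm S > 0"
    then have "(LINT t|lborel. (cmod (S (of_real t)))\<^sup>2) = 0"
      using pw_norm_nonneg[of S] by (simp flip: pw_norm_power2)
    moreover have c: "continuous_on UNIV (\<lambda>t::real. (cmod (S (of_real t)))\<^sup>2)"
      using continuous_on_cmod_power2[OF hol, of 0] by simp
    ultimately have "integral {0..1} (\<lambda>t. (cmod (S (of_real t)))\<^sup>2) \<le> 0"
      using integral_Icc_le_lborel[OF c _ \<open>integrable lborel _\<close>, of 0 1] by simp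
    moreover have "integral {0..1} (\<lambda>t. (cmod (S (of_real t)))\<^sup>2) \<ge> 0"
      by (intro integral_nonneg integrable_continuous_interval continuous_on_subset[OF c]) auto
    \<comment> \<open>A continuous nonnegative function with integral zero over
      \<open>[0, 1]\<close> vanishes there, whereas \<open>S 0 = \<epsilon>\<close>.\<close>
    ultimately have "(cmod (S (of_real 0)))\<^sup>2 = 0"
      using integral_eq_0_iff[OF continuous_on_subset[OF c], of 0 1] by force
    then show False using S0 e by simp
  qed
qed

text \<open>The lower bound is approached by \<open>z \<mapsto> exp (\<i> \<kappa> z) S z\<close>, where \<open>S\<close> has small type \<open>\<epsilon>\<close> and
  \<open>\<bar>\<kappa>\<bar> = a - \<epsilon>\<close>: these have almost all their spectrum at the end of \<open>[-a, a]\<close> that grows fastest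
  in the direction of \<open>Im w\<close>.\<close>

lemma pw_opnorm_affine:
  assumes a: "a > 0" and c: "c \<noteq> 0" "\<bar>c\<bar> \<le> 1"
    and T: "\<And>f. T f = (\<lambda>z. f (of_real c * z + w))"
  shows "pw_opnorm a T = exp (a * \<bar>Im w\<bar>) / sqrt \<bar>c\<bar>"
proof (rule antisym)
  define X where "X = {f \<in> paley_wiener a. pw_norm f \<le> 1}"
  let ?C = "exp (a * \<bar>Im w\<bar>) / sqrt \<bar>c\<bar>"
  have le: "pw_norm (T f) \<le> ?C" if "f \<in> X" for f
  proof -
    have "pw_norm (T f) \<le> ?C * pw_norm f"
      unfolding T using that by (intro pw_norm_affine_le a c) (auto simp: X_def)
    also have "\<dots> \<le> ?C * 1" using that by (intro mult_left_mono) (auto simp: X_def)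
    finally show ?thesis by simp
  qed
  obtain S0 where "S0 \<in> paley_wiener a" using paley_wiener_nontrivial[OF a] by blast
  \<comment> \<open>The zero function, obtained with \<kappa> and \<open>k\<close> both 0, shows
    that the supremum is over a nonempty set.\<close>
  then have "(\<lambda>z. exp (\<i> * of_real 0 * z) * (0 * S0 z)) \<in> X"
    unfolding X_def using paley_wiener_mult_exp[of S0 a 0 a 0] pw_norm_cmult[of 0 S0] by simp
  then have "X \<noteq> {}" by blast
  then show "pw_opnorm a T \<le> ?C"
    unfolding pw_opnorm_def X_def[symmetric] by (intro cSUP_least le)
  have bdd: "bdd_above ((\<lambda>f. pw_norm (T f)) ` X)" using le by (auto intro!: bdd_aboveI2)
  have main: "exp ((a - 2 * \<epsilon>) * \<bar>Im w\<bar>) / sqrt \<bar>c\<bar> \<le> pw_opnorm a T" if \<epsilon>: "\<epsilon> > 0" "\<epsilon> < a" for \<epsilon>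
  proof -
    obtain S where S: "S \<in> paley_wiener \<epsilon>" "pw_norm S > 0"
      using paley_wiener_nontrivial[OF \<epsilon>(1)] by blast
    \<comment> \<open>Since \<open>exp (\<i> * \<kappa> * z)\<close> has modulus
      \<open>exp (- \<kappa> * Im z)\<close>, the sign opposite to \<open>Im w\<close> makes the
      shift by \<open>w\<close> amplify it. For \<open>Im w = 0\<close> this gives \<kappa> = 0 and
      no amplification is wanted.\<close>
    define \<kappa> where "\<kappa> = - (a - \<epsilon>) * sgn (Im w)"
    define f where "f = (\<lambda>z. exp (\<i> * of_real \<kappa> * z) * (of_real (1 / pw_norm S) * S z))"
    have "\<epsilon> + \<bar>\<kappa>\<bar> \<le> a" using \<epsilon> by (auto simp: \<kappa>_def abs_mult sgn_if)
    then have "f \<in> paley_wiener a" unfolding f_def by (rule paley_wiener_mult_exp[OF S(1)])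
    moreover have "pw_norm f = 1"
    proof -
      have "pw_norm f = pw_norm (\<lambda>z. of_real (1 / pw_norm S) * S z)"
        by (rule pw_norm_cong) (simp add: f_def norm_mult norm_divide)
      then show ?thesis unfolding pw_norm_cmult using S(2) by (simp add: norm_divide)
    qed
    ultimately have "f \<in> X" by (simp add: X_def)
    have "\<kappa> * Im w = - ((a - \<epsilon>) * \<bar>Im w\<bar>)" by (simp add: \<kappa>_def abs_sgn algebra_simps)
    then have "pw_norm (T f) = pw_norm (\<lambda>z. of_real (exp ((a - \<epsilon>) * \<bar>Im w\<bar>) / pw_norm S) * S (of_real c * z + w))"
      unfolding T by (intro pw_norm_cong) (simp add: f_def norm_mult norm_divide)
    also have "\<dots> = exp ((a - \<epsilon>) * \<bar>Im w\<bar>) / pw_norm S * pw_norm (\<lambda>z. S (of_real c * z + w))"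
      unfolding pw_norm_cmult using S(2) by (simp add: norm_divide)
    \<comment> \<open>The unmodulated \<open>S\<close> has type \<epsilon>, so the shift can shrink
      its norm by at most \<open>exp (- \<epsilon> * \<bar>Im w\<bar>)\<close>; this second loss of
      \<epsilon> explains the exponent \<open>a - 2 * \<epsilon>\<close>.\<close>
    also have "\<dots> \<ge> exp ((a - \<epsilon>) * \<bar>Im w\<bar>) / pw_norm S * (exp (- (\<epsilon> * \<bar>Im w\<bar>)) / sqrt \<bar>c\<bar> * pw_norm S)"
      using S by (intro mult_left_mono pw_norm_affine_ge \<epsilon> c) auto
    also have "exp ((a - \<epsilon>) * \<bar>Im w\<bar>) / pw_norm S * (exp (- (\<epsilon> * \<bar>Im w\<bar>)) / sqrt \<bar>c\<bar> * pw_norm S)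
        = (exp ((a - \<epsilon>) * \<bar>Im w\<bar>) * exp (- (\<epsilon> * \<bar>Im w\<bar>))) / sqrt \<bar>c\<bar>"
      using S(2) by simp
    also have "exp ((a - \<epsilon>) * \<bar>Im w\<bar>) * exp (- (\<epsilon> * \<bar>Im w\<bar>)) = exp ((a - 2 * \<epsilon>) * \<bar>Im w\<bar>)"
      by (simp flip: exp_add add: algebra_simps)
    finally have "exp ((a - 2 * \<epsilon>) * \<bar>Im w\<bar>) / sqrt \<bar>c\<bar> \<le> pw_norm (T f)" .
    also have "\<dots> \<le> pw_opnorm a T"
      unfolding pw_opnorm_def X_def[symmetric] by (rule cSUP_upper[OF \<open>f \<in> X\<close> bdd])
    finally show ?thesis .
  qed
  have "((\<lambda>\<epsilon>. exp ((a - 2 * \<epsilon>) * \<bar>Im w\<bar>) / sqrt \<bar>c\<bar>) \<longlongrightarrow> exp ((a - 2 * 0) * \<bar>Im w\<bar>) / sqrt \<bar>c\<bar>) (at_right 0)"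
    using c by (intro tendsto_intros) auto
  moreover have "eventually (\<lambda>\<epsilon>. exp ((a - 2 * \<epsilon>) * \<bar>Im w\<bar>) / sqrt \<bar>c\<bar> \<le> pw_opnorm a T) (at_right 0)"
    using main a by (auto simp: eventually_at_right_field intro!: exI[of _ a])
  ultimately show "?C \<le> pw_opnorm a T"
    using tendsto_upperbound[of "\<lambda>\<epsilon>. exp ((a - 2 * \<epsilon>) * \<bar>Im w\<bar>) / sqrt \<bar>c\<bar>"
        "exp ((a - 2 * 0) * \<bar>Im w\<bar>) / sqrt \<bar>c\<bar>" "at_right 0" "pw_opnorm a T"] by simp
qed

section \<open>Iterates and the spectral radius\<close>

lemma composition_operator_affine_funpow:
  assumes "\<And>z. \<phi> z = of_real c * z + d"
  shows "(composition_operator \<phi> ^^ n) f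
         = (\<lambda>z. f (of_real (c ^ n) * z + d * of_real (\<Sum>k<n. c ^ k)))"
  by (induction n) (simp_all add: composition_operator_def assms o_def fun_eq_iff algebra_simps)

text \<open>The formula for the operator norm applies to every iterate. Writing the geometric sum as
  \<open>n\<close> times its average turns that norm into an exact \<open>n\<close>-th power, so its
  root depends on \<open>n\<close> only through the average.\<close>

lemma has_pw_spectral_radius_affine:
  assumes a: "a > 0" and c: "c \<noteq> 0" "\<bar>c\<bar> \<le> 1"
    and \<phi>: "\<And>z. \<phi> z = of_real c * z + d"
    and lim: "(\<lambda>n. (\<Sum>k<n. c ^ k) / real n) \<longlonglongrightarrow> s"
  shows "has_pw_spectral_radius a (composition_operator \<phi>) (exp (a * \<bar>Im d * s\<bar>) / sqrt \<bar>c\<bar>)"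
proof -
  let ?T = "composition_operator \<phi>"
  have T: "?T f = (\<lambda>z. f (of_real c * z + d))" for f
    by (simp add: composition_operator_def o_def \<phi>)
  have "pw_bounded_operator a ?T"
    unfolding pw_bounded_operator_def T
    using paley_wiener_affine[OF _ a c] pw_norm_affine_le[OF _ a c(1)] by blast
  moreover have "(\<lambda>n. root n (pw_opnorm a (?T ^^ n))) \<longlonglongrightarrow> exp (a * \<bar>Im d * s\<bar>) / sqrt \<bar>c\<bar>"
  proof (rule Lim_transform_eventually)
    show "(\<lambda>n. exp (a * \<bar>Im d * ((\<Sum>k<n. c ^ k) / real n)\<bar>) / sqrt \<bar>c\<bar>)
            \<longlonglongrightarrow> exp (a * \<bar>Im d * s\<bar>) / sqrt \<bar>c\<bar>"
      using c by (intro tendsto_intros lim) auto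
    \<comment> \<open>The identity starts at \<open>n = 1\<close>: for \<open>n = 0\<close> the
      right side is 0, the default value of \<open>root 0\<close>, while the left side is
      \<open>1 / sqrt \<bar>c\<bar>\<close>.\<close>
    have "exp (a * \<bar>Im d * ((\<Sum>k<n. c ^ k) / real n)\<bar>) / sqrt \<bar>c\<bar> = root n (pw_opnorm a (?T ^^ n))"
      if n: "n > 0" for n
    proof -
      have "\<bar>c ^ n\<bar> \<le> 1" using c by (simp add: power_abs power_le_one)
      then have "pw_opnorm a (?T ^^ n)
          = exp (a * \<bar>Im (d * of_real (\<Sum>k<n. c ^ k))\<bar>) / sqrt \<bar>c ^ n\<bar>"
        using c by (intro pw_opnorm_affine a composition_operator_affine_funpow \<phi>) auto
      also have "\<dots> = exp (real n * (a * \<bar>Im d * ((\<Sum>k<n. c ^ k) / real n)\<bar>)) / sqrt \<bar>c\<bar> ^ n"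
        using n by (simp add: power_abs real_sqrt_power abs_mult abs_divide del: of_real_sum)
      also have "\<dots> = (exp (a * \<bar>Im d * ((\<Sum>k<n. c ^ k) / real n)\<bar>) / sqrt \<bar>c\<bar>) ^ n"
        by (simp only: power_divide exp_of_nat_mult)
      finally show ?thesis using n by (simp add: real_root_power_cancel)
    qed
    then show "\<forall>\<^sub>F n in sequentially. exp (a * \<bar>Im d * ((\<Sum>k<n. c ^ k) / real n)\<bar>) / sqrt \<bar>c\<bar>
        = root n (pw_opnorm a (?T ^^ n))"
      by (rule eventually_sequentiallyI[of 1]) auto
  qed
  ultimately show ?thesis by (simp add: has_pw_spectral_radius_def)
qed

text \<open>The geometric sums themselves stay bounded by \<open>2 / \<bar>c - 1\<bar>\<close>,
  including at \<open>c = - 1\<close> where they oscillate, so dividing by \<open>n\<close> sends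
  them to 0.\<close>

lemma geometric_average_tendsto_0:
  fixes c :: real
  assumes "\<bar>c\<bar> \<le> 1" "c \<noteq> 1"
  shows "(\<lambda>n. (\<Sum>k<n. c ^ k) / real n) \<longlonglongrightarrow> 0"
proof (rule Lim_null_comparison)
  have "\<bar>(\<Sum>k<n. c ^ k) / real n\<bar> \<le> (2 / \<bar>c - 1\<bar>) / real n" for n
  proof -
    have "\<bar>c ^ n\<bar> \<le> 1" using assms by (simp add: power_abs power_le_one)
    then have "\<bar>c ^ n - 1\<bar> \<le> 2" by linarith
    then have "\<bar>c ^ n - 1\<bar> / \<bar>c - 1\<bar> / real n \<le> 2 / \<bar>c - 1\<bar> / real n"
      by (intro divide_right_mono) auto
    moreover have "\<bar>(\<Sum>k<n. c ^ k) / real n\<bar> = \<bar>c ^ n - 1\<bar> / \<bar>c - 1\<bar> / real n"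
      by (subst geometric_sum[OF assms(2)]) (simp only: abs_divide abs_of_nat)
    ultimately show ?thesis by (simp only:)
  qed
  then show "\<forall>\<^sub>F n in sequentially. norm ((\<Sum>k<n. c ^ k) / real n) \<le> (2 / \<bar>c - 1\<bar>) / real n"
    by simp
  show "(\<lambda>n. (2 / \<bar>c - 1\<bar>) / real n) \<longlonglongrightarrow> 0" by (rule lim_const_over_n)
qed

theorem proposition3p4:
  fixes a c :: real and d :: complex and \<phi> :: "complex \<Rightarrow> complex"
  assumes "a > 0" and "0 < \<bar>c\<bar>" and "\<bar>c\<bar> \<le> 1"
    and "\<And>z. \<phi> z = complex_of_real c * z + d"
  shows "(c = 1 \<longrightarrow>
            has_pw_spectral_radius a (composition_operator \<phi>) (exp (\<bar>Im d\<bar> * a))) \<and>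
         (c \<noteq> 1 \<longrightarrow>
            has_pw_spectral_radius a (composition_operator \<phi>) (1 / sqrt \<bar>c\<bar>))"
proof (intro conjI impI)
  assume c1: "c = 1"
  have "(\<lambda>n. (\<Sum>k<n. c ^ k) / real n) \<longlonglongrightarrow> 1"
    \<comment> \<open>Every average from \<open>n = 1\<close> on equals 1; the term at
      \<open>n = 0\<close> is \<open>0 / 0\<close>, which has the value 0.\<close>
    by (rule tendsto_eventually, rule eventually_sequentiallyI[of 1]) (simp add: c1)
  then show "has_pw_spectral_radius a (composition_operator \<phi>) (exp (\<bar>Im d\<bar> * a))"
    using has_pw_spectral_radius_affine[of a c \<phi> d 1] assms c1 by (simp add: mult.commute)
next
  assume "c \<noteq> 1"
  then show "has_pw_spectral_radius a (composition_operator \<phi>) (1 / sqrt \<bar>c\<bar>)"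
    using has_pw_spectral_radius_affine[of a c \<phi> d 0] geometric_average_tendsto_0[of c] assms by simp
qed

end
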